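(* Let $(S,d)$ be a metric space, let $m\in\mathbb N$, and let $h_1,\ldots,h_m:S\to\mathbb R$ be real-valued functions. Let $D$ be the set of probability distributions on $S$ concentrated on finite sets of points, let $$K:=\{\mu\in D:\ \langle h_i,\mu\rangle=0,\ i=1,\ldots,m\},$$ and for $j\in\mathbb N$ let $K_j$ be the set of $\mu\in K$ concentrated on at most $j$ points. Then for any quasiconvex function $g:K\to\mathbb R$, $$\sup_{\mu\in K} g(\mu)=\sup_{\mu\in K_{m+1}} g(\mu).$$
   Context: For a function $f:S\to\mathbb R$ and a measure $\mu\in D$, $\langle f,\mu\rangle:=\int_S f\,d\mu$ (a finite sum). Measures are on the Borel $\sigma$-algebra of $S$; signed finite measures form a linear space under pointwise addition and scalar multiplication, in which $D$ and $K$ are convex subsets. A function $g:G\to\mathbb R$ on a convex set $G$ is quasiconvex if $g(\alpha x+(1-\alpha)y)\le\max\{g(x),g(y)\}$ for all $x,y\in G$ and $\alpha\in(0,1)$. Convention: the supremum over the empty set is zero. Suprema may be $+\infty$. *)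

theory Defs
  imports "HOL-Probability.Probability"
begin

text \<open>
  A metric space is a carrier set \<open>S\<close> with a distance \<open>d\<close> satisfying \<^locale>\<open>Metric_space\<close>; in
  particular \<open>S\<close> may be empty.
\<close>

definition metric_borel :: "'a set \<Rightarrow> ('a \<Rightarrow> 'a \<Rightarrow> real) \<Rightarrow> 'a measure" where
  "metric_borel S d = sigma S {U. openin (Metric_space.mtopology S d) U}"

definition finite_dists :: "'a set \<Rightarrow> ('a \<Rightarrow> 'a \<Rightarrow> real) \<Rightarrow> 'a measure set" where
  "finite_dists S d = {\<mu>. sets \<mu> = sets (metric_borel S d) \<and> prob_space \<mu> \<and>
     (\<exists>F. finite F \<and> F \<subseteq> S \<and> measure \<mu> F = 1)}"

text \<open>
  The functions \<open>f\<close> need not be Borel measurable, whereas the Bochner integral of a non-measurable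
  function is \<open>0\<close> by convention. The integral is therefore taken with respect to the completion
  of \<open>\<mu>\<close>: for \<open>\<mu>\<close> concentrated on a finite set every \<open>f\<close> is integrable with respect to the
  completion, and its integral is the expected finite sum (see \<open>pairing_eq_sum\<close> below).
\<close>

definition pairing :: "('a \<Rightarrow> real) \<Rightarrow> 'a measure \<Rightarrow> real" where
  "pairing f \<mu> = (\<integral>x. f x \<partial>completion \<mu>)"

definition moment_set ::
  "'a set \<Rightarrow> ('a \<Rightarrow> 'a \<Rightarrow> real) \<Rightarrow> nat \<Rightarrow> (nat \<Rightarrow> 'a \<Rightarrow> real) \<Rightarrow> 'a measure set" where
  "moment_set S d m h = {\<mu> \<in> finite_dists S d. \<forall>i\<in>{1..m}. pairing (h i) \<mu> = 0}"

definition moment_set_pts ::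
  "'a set \<Rightarrow> ('a \<Rightarrow> 'a \<Rightarrow> real) \<Rightarrow> nat \<Rightarrow> (nat \<Rightarrow> 'a \<Rightarrow> real) \<Rightarrow> nat \<Rightarrow> 'a measure set" where
  "moment_set_pts S d m h j = {\<mu> \<in> moment_set S d m h.
     \<exists>F. finite F \<and> card F \<le> j \<and> F \<subseteq> S \<and> measure \<mu> F = 1}"

text \<open>
  Pointwise addition is meaningful for measures on the same \<open>\<sigma>\<close>-algebra, and \<open>mixture \<alpha> \<mu> \<nu>\<close> is
  \<open>\<alpha> \<mu> + (1 - \<alpha>) \<nu>\<close> for \<open>0 \<le> \<alpha> \<le> 1\<close>.
\<close>

definition add_measure :: "'a measure \<Rightarrow> 'a measure \<Rightarrow> 'a measure" where
  "add_measure M N = measure_of (space M) (sets M) (\<lambda>A. emeasure M A + emeasure N A)"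

definition mixture :: "real \<Rightarrow> 'a measure \<Rightarrow> 'a measure \<Rightarrow> 'a measure" where
  "mixture \<alpha> \<mu> \<nu> =
     add_measure (scale_measure (ennreal \<alpha>) \<mu>) (scale_measure (ennreal (1 - \<alpha>)) \<nu>)"

text \<open>
  Only the values of \<open>g\<close> on \<open>G\<close> matter, provided \<open>G\<close> is closed under mixtures; for the sets
  \<^const>\<open>moment_set\<close> this is \<open>mixture_in_moment_set\<close> below.
\<close>

definition quasiconvex_on :: "'a measure set \<Rightarrow> ('a measure \<Rightarrow> real) \<Rightarrow> bool" where
  "quasiconvex_on G g \<longleftrightarrow>
     (\<forall>\<mu>\<in>G. \<forall>\<nu>\<in>G. \<forall>\<alpha>\<in>{0<..<1}. g (mixture \<alpha> \<mu> \<nu>) \<le> max (g \<mu>) (g \<nu>))"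

text \<open>Supremum in the extended reals, but with value \<open>0\<close> (not \<open>-\<infinity>\<close>) on the empty set.\<close>

definition sup0 :: "ereal set \<Rightarrow> ereal" where
  "sup0 A = (if A = {} then 0 else Sup A)"

lemma sets_add_measure [simp]: "sets (add_measure M N) = sets M"
  by (simp add: add_measure_def)

lemma emeasure_add_measure:
  assumes "sets M = sets N"
  shows "emeasure (add_measure M N) A = emeasure M A + emeasure N A"
proof (cases "A \<in> sets M")
  case True
  show ?thesis unfolding add_measure_def
  proof (rule emeasure_measure_of_sigma)
    show "sigma_algebra (space M) (sets M)" ..
    show "positive (sets M) (\<lambda>A. emeasure M A + emeasure N A)"
      by (simp add: positive_def)
    show "countably_additive (sets M) (\<lambda>A. emeasure M A + emeasure N A)"
    proof (rule countably_additiveI)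
      fix A :: "nat \<Rightarrow> _"
      assume A: "range A \<subseteq> sets M" "disjoint_family A"
      then have "range A \<subseteq> sets N" using assms by simp
      then show "(\<Sum>i. emeasure M (A i) + emeasure N (A i)) =
          emeasure M (\<Union>i. A i) + emeasure N (\<Union>i. A i)"
        using A by (simp add: suminf_add[symmetric] suminf_emeasure)
    qed
  qed (fact True)
next
  case False
  then show ?thesis using assms by (simp add: emeasure_notin_sets)
qed

lemma sets_mixture [simp]: "sets (mixture \<alpha> \<mu> \<nu>) = sets \<mu>"
  by (simp add: mixture_def)

lemma emeasure_mixture:
  assumes "sets \<mu> = sets \<nu>"
  shows "emeasure (mixture \<alpha> \<mu> \<nu>) A = ennreal \<alpha> * emeasure \<mu> A + ennreal (1 - \<alpha>) * emeasure \<nu> A"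
  using assms by (simp add: mixture_def emeasure_add_measure)

lemma measure_mixture:
  assumes "sets \<mu> = sets \<nu>" "finite_measure \<mu>" "finite_measure \<nu>" "0 \<le> \<alpha>" "\<alpha> \<le> 1"
  shows "measure (mixture \<alpha> \<mu> \<nu>) A = \<alpha> * measure \<mu> A + (1 - \<alpha>) * measure \<nu> A"
proof -
  have "emeasure (mixture \<alpha> \<mu> \<nu>) A = ennreal (\<alpha> * measure \<mu> A + (1 - \<alpha>) * measure \<nu> A)"
    using assms
    by (simp add: emeasure_mixture finite_measure.emeasure_eq_measure ennreal_mult ennreal_plus)
  then show ?thesis
    using assms by (intro measure_eq_emeasure_eq_ennreal) auto
qed

lemma space_finite_dists: "\<mu> \<in> finite_dists S d \<Longrightarrow> space \<mu> = S"
  using sets_eq_imp_space_eq[of \<mu> "metric_borel S d"]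
  by (simp add: finite_dists_def metric_borel_def space_measure_of_conv)

lemma finite_in_sets_metric_borel:
  assumes "Metric_space S d" "finite F" "F \<subseteq> S"
  shows "F \<in> sets (metric_borel S d)"
proof -
  interpret Metric_space S d by fact
  have *: "sets (metric_borel S d) = sigma_sets S {U. openin mtopology U}"
    unfolding metric_borel_def by (rule sets_measure_of) (use openin_subset[of mtopology] in auto)
  have "closedin mtopology F"
    using assms closedin_Hausdorff_finite[OF Hausdorff_space_mtopology] by simp
  then have "openin mtopology (S - F)"
    by (simp add: closedin_def)
  then have "S - (S - F) \<in> sigma_sets S {U. openin mtopology U}"
    by (intro sigma_sets.Compl sigma_sets.Basic) simp
  then show ?thesis
    using assms * by (simp add: double_diff)
qed

lemma integrable_pairing_eq_sum:
  assumes S: "Metric_space S d" and \<mu>: "\<mu> \<in> finite_dists S d"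
    and F: "finite F" "F \<subseteq> S" "measure \<mu> F = 1"
  shows "integrable (completion \<mu>) f" and "pairing f \<mu> = (\<Sum>x\<in>F. f x * measure \<mu> {x})"
proof -
  interpret prob_space \<mu>
    using \<mu> by (simp add: finite_dists_def)
  have sp: "space \<mu> = S"
    by (rule space_finite_dists[OF \<mu>])
  have fin: "B \<in> sets \<mu>" if "finite B" "B \<subseteq> S" for B
    using finite_in_sets_metric_borel[OF S that] \<mu> by (simp add: finite_dists_def)
  have AE: "AE x in \<mu>. x \<in> F"
    by (rule AE_prob_1[OF F(3)])
  have null: "S - F \<in> null_sets \<mu>"
    using AE fin[of F] F AE_iff_null_sets[of "S - F" \<mu>] sp
    by (metis (mono_tags, lifting) AE_E2 AE_mp AE_I2 Diff_iff sets.compl_sets)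
  have sets: "B \<in> sets (completion \<mu>)" if "B \<subseteq> S" for B
  proof (rule sets_completionI[of _ "B \<inter> F" "B - F" "S - F"])
    show "B = B \<inter> F \<union> (B - F)" by blast
    show "B - F \<subseteq> S - F" using that by blast
    show "S - F \<in> null_sets \<mu>" by fact
    show "B \<inter> F \<in> sets \<mu>" using fin[of "B \<inter> F"] F by blast
  qed
  have meas: "f \<in> borel_measurable (completion \<mu>)"
    by (rule measurableI) (auto intro!: sets simp: sp)
  have fin': "{a} \<in> sets (completion \<mu>)" if "a \<in> F" for a
    using sets[of "{a}"] that F by blast
  have fm: "finite_measure (completion \<mu>)"
    by (rule finite_measureI) (simp add: emeasure_space_1)
  have eq: "AE x in completion \<mu>. (\<Sum>a\<in>F. indicator {a} x * f a) = f x"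
  proof (rule AE_completion, use AE in eventually_elim)
    fix x assume "x \<in> F"
    then show "(\<Sum>a\<in>F. indicator {a} x * f a) = f x"
      using F(1) by (simp add: indicator_def sum.delta)
  qed
  have int: "integrable (completion \<mu>) (\<lambda>x. indicator {a} x * f a)" if "a \<in> F" for a
    using fin'[OF that] finite_measure.emeasure_finite[OF fm]
    by (intro integrable_mult_left integrable_real_indicator)
       (auto simp: less_top simp del: emeasure_completion)
  have meas': "(\<lambda>x. \<Sum>a\<in>F. indicator {a} x * f a) \<in> borel_measurable (completion \<mu>)"
    by (intro borel_measurable_sum borel_measurable_integrable int)
  have "integrable (completion \<mu>) (\<lambda>x. \<Sum>a\<in>F. indicator {a} x * f a)"
    using int by (rule Bochner_Integration.integrable_sum)
  then show "integrable (completion \<mu>) f"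
    using integrable_cong_AE[OF meas' meas eq] by blast
  have "pairing f \<mu> = (\<integral>x. (\<Sum>a\<in>F. indicator {a} x * f a) \<partial>completion \<mu>)"
    unfolding pairing_def using integral_cong_AE[OF meas' meas eq] by simp
  also have "\<dots> = (\<Sum>a\<in>F. \<integral>x. indicator {a} x * f a \<partial>completion \<mu>)"
    using int by (rule Bochner_Integration.integral_sum)
  also have "\<dots> = (\<Sum>a\<in>F. f a * measure \<mu> {a})"
  proof (rule sum.cong)
    fix a assume a: "a \<in> F"
    then have "{a} \<in> sets \<mu>" using fin[of "{a}"] F by blast
    then show "(\<integral>x. indicator {a} x * f a \<partial>completion \<mu>) = f a * measure \<mu> {a}"
      using a F sp by (simp add: measure_completion Int_absorb2 subset_iff)
  qed simp
  finally show "pairing f \<mu> = (\<Sum>x\<in>F. f x * measure \<mu> {x})" .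
qed

lemmas pairing_eq_sum = integrable_pairing_eq_sum(2)

lemma mixture_in_moment_set:
  assumes S: "Metric_space S d" and \<alpha>: "0 < \<alpha>" "\<alpha> < 1"
    and \<mu>: "\<mu> \<in> moment_set S d m h" and \<nu>: "\<nu> \<in> moment_set S d m h"
  shows "mixture \<alpha> \<mu> \<nu> \<in> moment_set S d m h"
proof -
  let ?M = "mixture \<alpha> \<mu> \<nu>"
  have D: "\<mu> \<in> finite_dists S d" "\<nu> \<in> finite_dists S d"
    using \<mu> \<nu> by (auto simp: moment_set_def)
  then obtain F F' where F: "finite F" "F \<subseteq> S" "measure \<mu> F = 1"
    and F': "finite F'" "F' \<subseteq> S" "measure \<nu> F' = 1"
    by (auto simp: finite_dists_def)
  interpret M: prob_space \<mu> using D by (simp add: finite_dists_def)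
  interpret N: prob_space \<nu> using D by (simp add: finite_dists_def)
  have s: "sets \<mu> = sets \<nu>" "sets \<mu> = sets (metric_borel S d)"
    using D by (auto simp: finite_dists_def)
  have U: "finite (F \<union> F')" "F \<union> F' \<subseteq> S" using F F' by auto
  have Us: "F \<union> F' \<in> sets \<mu>" "F \<union> F' \<in> sets \<nu>"
    using finite_in_sets_metric_borel[OF S U] s by auto
  have "measure \<mu> F \<le> measure \<mu> (F \<union> F')" "measure \<nu> F' \<le> measure \<nu> (F \<union> F')"
    using Us by (auto intro!: M.finite_measure_mono N.finite_measure_mono)
  then have U1: "measure \<mu> (F \<union> F') = 1" "measure \<nu> (F \<union> F') = 1"
    using F F' M.prob_le_1[of "F \<union> F'"] N.prob_le_1[of "F \<union> F'"] by linarith+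
  have mm: "measure ?M A = \<alpha> * measure \<mu> A + (1 - \<alpha>) * measure \<nu> A" for A
    using s(1) \<alpha> by (intro measure_mixture) (auto intro: M.finite_measure_axioms N.finite_measure_axioms)
  have sp: "space ?M = space \<mu>" "space \<mu> = space \<nu>"
    using s by (auto intro!: sets_eq_imp_space_eq)
  have "emeasure ?M (space ?M) = ennreal \<alpha> + ennreal (1 - \<alpha>)"
    using sp s M.emeasure_space_1 N.emeasure_space_1 by (simp add: emeasure_mixture)
  also have "\<dots> = 1"
    using \<alpha> by (simp add: ennreal_plus[symmetric] del: ennreal_plus)
  finally have "prob_space ?M" by (rule prob_spaceI)
  moreover have M1: "measure ?M (F \<union> F') = 1"
    using U1 by (simp add: mm)
  ultimately have MD: "?M \<in> finite_dists S d"
    using s U by (auto simp: finite_dists_def)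
  have "pairing f ?M = \<alpha> * pairing f \<mu> + (1 - \<alpha>) * pairing f \<nu>" for f
    by (simp add: pairing_eq_sum[OF S MD U M1] pairing_eq_sum[OF S D(1) U U1(1)]
        pairing_eq_sum[OF S D(2) U U1(2)] mm sum_distrib_left sum.distrib[symmetric] algebra_simps)
  then show ?thesis
    using MD \<mu> \<nu> by (simp add: moment_set_def)
qed

end

(* A measure in K concentrated on more than m + 1 atoms admits a nonzero signed perturbation of its
   weights which preserves the total mass and the m moments, since these are m + 1 linear conditions.
   Moving along this direction both ways until a weight vanishes writes the measure as a mixture of
   two measures in K with fewer atoms, and by quasiconvexity g does not decrease at one of them. *)
theory Submission
  imports Defs
begin

section \<open>Homogeneous linear systems and boundary steps for weights on a finite set\<close>

text \<open>Gaussian elimination, by induction on the number of equations: a pivot \<open>y\<close>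
  of the last equation removes one equation and one unknown, so there remain more unknowns than
  equations.\<close>

lemma exists_nontrivial_solution:
  fixes a :: "nat \<Rightarrow> 'a \<Rightarrow> real"
  assumes "finite F" "k < card F"
  shows "\<exists>v. (\<exists>x\<in>F. v x \<noteq> 0) \<and> (\<forall>i<k. (\<Sum>x\<in>F. a i x * v x) = 0)"
  using assms
proof (induction k arbitrary: F a)
  case 0
  then obtain x where "x \<in> F" by fastforce
  then show ?case by (intro exI[of _ "\<lambda>_. 1"]) auto
next
  case (Suc k)
  show ?case
  proof (cases "\<forall>x\<in>F. a k x = 0")
    case True
    obtain v where "\<exists>x\<in>F. v x \<noteq> 0" "\<forall>i<k. (\<Sum>x\<in>F. a i x * v x) = 0"
      using Suc.IH[of F a] Suc.prems by auto
    then show ?thesis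
      using True by (intro exI[of _ v]) (auto simp: less_Suc_eq)
  next
    case False
    then obtain y where y: "y \<in> F" "a k y \<noteq> 0" by blast
    \<comment> \<open>Row \<open>?b i\<close> is row \<open>i\<close> minus the multiple of row
      \<open>k\<close> that cancels its entry at \<open>y\<close>.\<close>
    let ?G = "F - {y}" and ?b = "\<lambda>i x. a i x - a i y * a k x / a k y"
    have "finite ?G" "k < card ?G" using Suc.prems y by auto
    then obtain v where v: "\<exists>x\<in>?G. v x \<noteq> 0" "\<And>i. i < k \<Longrightarrow> (\<Sum>x\<in>?G. ?b i x * v x) = 0"
      using Suc.IH[of ?G ?b] by blast
    \<comment> \<open>The value at the pivot is the one that equation \<open>k\<close> forces once
      the other unknowns are given by \<open>v\<close>.\<close>
    define w where "w = v(y := - (\<Sum>x\<in>?G. a k x * v x) / a k y)"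
    have sum_w: "(\<Sum>x\<in>F. a i x * w x) =
        (\<Sum>x\<in>?G. a i x * v x) - a i y * (\<Sum>x\<in>?G. a k x * v x) / a k y" for i
    proof -
      have "(\<Sum>x\<in>F. a i x * w x) = a i y * w y + (\<Sum>x\<in>?G. a i x * w x)"
        using Suc.prems y by (simp add: sum.remove)
      also have "(\<Sum>x\<in>?G. a i x * w x) = (\<Sum>x\<in>?G. a i x * v x)"
        by (intro sum.cong) (auto simp: w_def)
      finally show ?thesis by (simp add: w_def)
    qed
    have "(\<Sum>x\<in>F. a i x * w x) = 0" if "i < Suc k" for i
    proof (cases "i = k")
      case True
      then show ?thesis using y by (simp add: sum_w)
    next
      case False
      then have "(\<Sum>x\<in>?G. ?b i x * v x) = 0" using that v(2) by simp
      moreover have "(\<Sum>x\<in>?G. ?b i x * v x) =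
          (\<Sum>x\<in>?G. a i x * v x) - a i y * (\<Sum>x\<in>?G. a k x * v x) / a k y"
        by (simp add: left_diff_distrib sum_subtractf sum_distrib_left sum_divide_distrib mult.assoc)
      ultimately show ?thesis by (simp add: sum_w)
    qed
    moreover have "\<exists>x\<in>F. w x \<noteq> 0" using v(1) by (auto simp: w_def)
    ultimately show ?thesis by blast
  qed
qed

text \<open>The ratio test of the simplex method: only points with \<open>v x < 0\<close> lose
  weight, the one at \<open>x\<close> reaches zero at time \<open>p x / - v x\<close>, and the least
  of these times is the step length \<open>t\<close>.\<close>

lemma exists_boundary_step:
  fixes p v :: "'a \<Rightarrow> real"
  assumes "finite F" "\<And>x. x \<in> F \<Longrightarrow> 0 < p x" "\<exists>x\<in>F. v x < 0"
  obtains t z where "0 < t" "z \<in> F" "p z + t * v z = 0" "\<And>x. x \<in> F \<Longrightarrow> 0 \<le> p x + t * v x"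
proof -
  let ?N = "{x\<in>F. v x < 0}" and ?r = "\<lambda>x. p x / - v x"
  have N: "finite (?r ` ?N)" "?r ` ?N \<noteq> {}" using assms by auto
  obtain z where z: "z \<in> ?N" "Min (?r ` ?N) = ?r z"
    using Min_in[OF N] by blast
  show ?thesis
  proof
    show "0 < ?r z" using z assms(2)[of z] by (simp add: divide_pos_neg)
    show "z \<in> F" using z by simp
    show "p z + ?r z * v z = 0" using z by simp
    fix x assume x: "x \<in> F"
    show "0 \<le> p x + ?r z * v x"
    proof (cases "v x < 0")
      case True
      then have "?r z \<le> ?r x"
        using Min_le[OF N(1), of "?r x"] x z by simp
      then have "?r z * - v x \<le> ?r x * - v x"
        using True by (intro mult_right_mono) auto
      then show ?thesis using True by simp
    next
      case False
      then show ?thesis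
        using \<open>0 < ?r z\<close> assms(2)[OF x] by (intro add_nonneg_nonneg mult_nonneg_nonneg) auto
    qed
  qed
qed

text \<open>Terms of one sign sum to zero only if all vanish. Both signs are wanted, so that a
  boundary is met in the direction \<open>v\<close> as well as in \<open>- v\<close>.\<close>

lemma exists_signs_of_sum_eq_0:
  fixes v :: "'a \<Rightarrow> real"
  assumes "finite F" "(\<Sum>x\<in>F. v x) = 0" "\<exists>x\<in>F. v x \<noteq> 0"
  shows "\<exists>x\<in>F. v x < 0" and "\<exists>x\<in>F. 0 < v x"
proof -
  show "\<exists>x\<in>F. v x < 0"
    using assms sum_nonneg_eq_0_iff[of F v] by (meson not_le)
  show "\<exists>x\<in>F. 0 < v x"
    using assms sum_nonneg_eq_0_iff[of F "\<lambda>x. - v x"] by (force simp: sum_negf not_le)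
qed

section \<open>Measures given by weights on a finite set\<close>

text \<open>\<open>point_measure F\<close> carries all subsets of \<open>F\<close> as its measurable
  sets; the image under the identity moves it to the Borel sets of \<open>S\<close>. Negative
  weights would be cut off to 0 by \<open>ennreal\<close>, hence the sign hypotheses below.\<close>

definition atomic_measure ::
  "'a set \<Rightarrow> ('a \<Rightarrow> 'a \<Rightarrow> real) \<Rightarrow> 'a set \<Rightarrow> ('a \<Rightarrow> real) \<Rightarrow> 'a measure" where
  "atomic_measure S d F p = distr (point_measure F (\<lambda>x. ennreal (p x))) (metric_borel S d) (\<lambda>x. x)"

lemma sets_atomic_measure [simp]: "sets (atomic_measure S d F p) = sets (metric_borel S d)"
  by (simp add: atomic_measure_def)

lemma space_metric_borel [simp]: "space (metric_borel S d) = S"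
  by (simp add: metric_borel_def space_measure_of_conv)

text \<open>With indicators the sum runs over \<open>F\<close> for every \<open>A\<close>, which
  makes it visibly linear in \<open>p\<close>.\<close>

lemma emeasure_atomic_measure:
  assumes "finite F" "F \<subseteq> S" "\<And>x. x \<in> F \<Longrightarrow> 0 \<le> p x" "A \<in> sets (metric_borel S d)"
  shows "emeasure (atomic_measure S d F p) A = ennreal (\<Sum>x\<in>F. p x * indicator A x)"
proof -
  have "emeasure (atomic_measure S d F p) A = emeasure (point_measure F (\<lambda>x. ennreal (p x))) (A \<inter> F)"
    unfolding atomic_measure_def using assms
    by (subst emeasure_distr) (auto simp: measurable_point_measure_eq1 space_point_measure)
  also have "\<dots> = (\<Sum>x\<in>A \<inter> F. ennreal (p x))"
    using assms by (intro emeasure_point_measure_finite) auto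
  also have "\<dots> = ennreal (\<Sum>x\<in>A \<inter> F. p x)"
    using assms by (intro sum_ennreal) auto
  also have "(\<Sum>x\<in>A \<inter> F. p x) = (\<Sum>x\<in>F. p x * indicator A x)"
    using assms by (simp add: sum.inter_restrict Int_commute indicator_def if_distrib cong: if_cong)
  finally show ?thesis .
qed

lemma measure_atomic_measure:
  assumes "finite F" "F \<subseteq> S" "\<And>x. x \<in> F \<Longrightarrow> 0 \<le> p x" "A \<in> sets (metric_borel S d)"
  shows "measure (atomic_measure S d F p) A = (\<Sum>x\<in>F. p x * indicator A x)"
  using emeasure_atomic_measure[OF assms] assms(3)
  by (intro measure_eq_emeasure_eq_ennreal) (auto intro!: sum_nonneg)

lemma atomic_measure_in_finite_dists:
  assumes "Metric_space S d" "finite F" "F \<subseteq> S" "\<And>x. x \<in> F \<Longrightarrow> 0 \<le> p x" "(\<Sum>x\<in>F. p x) = 1"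
  shows "atomic_measure S d F p \<in> finite_dists S d" and "measure (atomic_measure S d F p) F = 1"
proof -
  note F = finite_in_sets_metric_borel[OF assms(1-3)]
  show 1: "measure (atomic_measure S d F p) F = 1"
    using assms F by (subst measure_atomic_measure) auto
  have "S \<in> sets (metric_borel S d)" using sets.top[of "metric_borel S d"] by simp
  moreover have "(\<Sum>x\<in>F. p x * indicator S x) = (\<Sum>x\<in>F. p x)"
    using assms(3) by (intro sum.cong) auto
  ultimately have "emeasure (atomic_measure S d F p) S = 1"
    using assms by (subst emeasure_atomic_measure) auto
  then have "prob_space (atomic_measure S d F p)"
    by (intro prob_spaceI) (simp add: atomic_measure_def)
  then show "atomic_measure S d F p \<in> finite_dists S d"
    using 1 assms by (auto simp: finite_dists_def)
qed

lemma pairing_atomic_measure: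
  assumes "Metric_space S d" "finite F" "F \<subseteq> S" "\<And>x. x \<in> F \<Longrightarrow> 0 \<le> p x" "(\<Sum>x\<in>F. p x) = 1"
  shows "pairing f (atomic_measure S d F p) = (\<Sum>x\<in>F. f x * p x)"
proof -
  have "measure (atomic_measure S d F p) {x} = p x" if "x \<in> F" for x
  proof -
    have "{x} \<in> sets (metric_borel S d)"
      using that assms by (intro finite_in_sets_metric_borel) auto
    then have "measure (atomic_measure S d F p) {x} = (\<Sum>y\<in>F. p y * indicator {x} y)"
      using assms by (intro measure_atomic_measure) auto
    also have "\<dots> = p x"
      using that assms(2) by (simp add: indicator_def if_distrib cong: if_cong)
    finally show ?thesis .
  qed
  then show ?thesis
    using assms by (simp add: pairing_eq_sum[OF _ atomic_measure_in_finite_dists(1) _ _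
        atomic_measure_in_finite_dists(2)])
qed

text \<open>\<open>A\<close> and \<open>A \<inter> F\<close> differ by a null set, and the finite
  set \<open>A \<inter> F\<close> splits into measurable singletons. Hence every measure in
  \<open>finite_dists S d\<close> can be handled through its weights.\<close>

lemma eq_atomic_measure:
  assumes S: "Metric_space S d" and \<mu>: "\<mu> \<in> finite_dists S d"
    and F: "finite F" "F \<subseteq> S" "measure \<mu> F = 1"
  shows "\<mu> = atomic_measure S d F (\<lambda>x. measure \<mu> {x})"
proof (rule measure_eqI)
  interpret prob_space \<mu> using \<mu> by (simp add: finite_dists_def)
  show s: "sets \<mu> = sets (atomic_measure S d F (\<lambda>x. measure \<mu> {x}))"
    using \<mu> by (simp add: finite_dists_def)
  have fin: "B \<in> sets \<mu>" if "finite B" "B \<subseteq> S" for B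
    using finite_in_sets_metric_borel[OF S that] s by simp
  fix A assume A: "A \<in> sets \<mu>"
  have AF: "A \<inter> F \<in> sets \<mu>" using F by (intro fin) auto
  have "prob A = prob (A \<inter> F)"
    using AE_prob_1[OF F(3)] A AF by (intro finite_measure_eq_AE) auto
  also have "\<dots> = (\<Sum>x\<in>A \<inter> F. prob {x})"
    using F by (intro finite_measure_eq_sum_singleton) (auto intro!: fin)
  also have "\<dots> = (\<Sum>x\<in>F. prob {x} * indicator A x)"
    using F by (simp add: sum.inter_restrict Int_commute indicator_def if_distrib cong: if_cong)
  finally show "emeasure \<mu> A = emeasure (atomic_measure S d F (\<lambda>x. prob {x})) A"
    using A F s by (simp add: emeasure_eq_measure emeasure_atomic_measure)
qed

lemma atomic_measure_remove_zero:
  assumes "finite F" "F \<subseteq> S" "\<And>x. x \<in> F \<Longrightarrow> 0 \<le> p x" "p z = 0"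
  shows "atomic_measure S d F p = atomic_measure S d (F - {z}) p"
proof (rule measure_eqI)
  fix A assume "A \<in> sets (atomic_measure S d F p)"
  moreover have "(\<Sum>x\<in>F. p x * indicator A x) = (\<Sum>x\<in>F - {z}. p x * indicator A x)"
    using assms by (intro sum.mono_neutral_right) auto
  ultimately show "emeasure (atomic_measure S d F p) A = emeasure (atomic_measure S d (F - {z}) p) A"
    using assms by (subst (1 2) emeasure_atomic_measure) auto
qed simp

text \<open>Turns a convex combination of weights into a mixture of measures, the form in which
  quasiconvexity is stated.\<close>

lemma mixture_atomic_measure:
  assumes "finite F" "F \<subseteq> S" "0 < \<alpha>" "\<alpha> < 1"
    and "\<And>x. x \<in> F \<Longrightarrow> 0 \<le> p x" "\<And>x. x \<in> F \<Longrightarrow> 0 \<le> q x"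
  shows "mixture \<alpha> (atomic_measure S d F p) (atomic_measure S d F q) =
    atomic_measure S d F (\<lambda>x. \<alpha> * p x + (1 - \<alpha>) * q x)"
proof (rule measure_eqI)
  fix A assume "A \<in> sets (mixture \<alpha> (atomic_measure S d F p) (atomic_measure S d F q))"
  then have A: "A \<in> sets (metric_borel S d)" by simp
  define P Q where "P = (\<Sum>x\<in>F. p x * indicator A x)" and "Q = (\<Sum>x\<in>F. q x * indicator A x)"
  have PQ: "0 \<le> P" "0 \<le> Q"
    unfolding P_def Q_def using assms by (auto intro!: sum_nonneg)
  have "emeasure (mixture \<alpha> (atomic_measure S d F p) (atomic_measure S d F q)) A =
      ennreal \<alpha> * ennreal P + ennreal (1 - \<alpha>) * ennreal Q"
    unfolding P_def Q_def using assms A by (simp only: emeasure_mixture sets_atomic_measure emeasure_atomic_measure)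
  also have "\<dots> = ennreal (\<alpha> * P + (1 - \<alpha>) * Q)"
    using PQ assms(3,4) by (simp add: ennreal_mult ennreal_plus)
  also have "\<alpha> * P + (1 - \<alpha>) * Q =
      (\<Sum>x\<in>F. (\<alpha> * p x + (1 - \<alpha>) * q x) * indicator A x)"
    unfolding P_def Q_def
    by (simp add: sum_distrib_left sum.distrib distrib_right mult.assoc)
  finally show "emeasure (mixture \<alpha> (atomic_measure S d F p) (atomic_measure S d F q)) A =
      emeasure (atomic_measure S d F (\<lambda>x. \<alpha> * p x + (1 - \<alpha>) * q x)) A"
    using assms A by (simp add: emeasure_atomic_measure)
qed simp

section \<open>Reduction to at most m + 1 atoms\<close>

text \<open>Zero weights are allowed, so that the end points of a boundary step can still be indexed
  by the same \<open>F\<close>.\<close>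

definition moment_weights ::
  "nat \<Rightarrow> (nat \<Rightarrow> 'a \<Rightarrow> real) \<Rightarrow> 'a set \<Rightarrow> ('a \<Rightarrow> real) \<Rightarrow> bool" where
  "moment_weights m h F p \<longleftrightarrow> (\<forall>x\<in>F. 0 \<le> p x) \<and> (\<Sum>x\<in>F. p x) = 1 \<and>
     (\<forall>i\<in>{1..m}. (\<Sum>x\<in>F. h i x * p x) = 0)"

lemma atomic_measure_in_moment_set:
  assumes "Metric_space S d" "finite F" "F \<subseteq> S" "moment_weights m h F p"
  shows "atomic_measure S d F p \<in> moment_set S d m h"
  using assms
  by (simp add: moment_weights_def moment_set_def atomic_measure_in_finite_dists pairing_atomic_measure)

lemma moment_weights_remove_zero:
  assumes "finite F" "moment_weights m h F p" "p z = 0"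
  shows "moment_weights m h (F - {z}) p"
proof -
  have "(\<Sum>x\<in>F - {z}. f x * p x) = (\<Sum>x\<in>F. f x * p x)" for f :: "'a \<Rightarrow> real"
    using assms by (intro sum.mono_neutral_left) auto
  \<comment> \<open>The constant function 1 gives the total mass, \<open>h i\<close> the
    moments.\<close>
  from this[of "\<lambda>_. 1"] this show ?thesis
    using assms by (simp add: moment_weights_def)
qed

text \<open>The induction is on the number of listed points, not on the true support; a point of
  weight zero is therefore a case of its own.\<close>

lemma exists_few_atoms_quasiconvex_ge:
  assumes S: "Metric_space S d" and g: "quasiconvex_on (moment_set S d m h) g"
    and "finite F" "F \<subseteq> S" "moment_weights m h F p"
  shows "\<exists>\<nu>\<in>moment_set_pts S d m h (m + 1). g (atomic_measure S d F p) \<le> g \<nu>"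
  using assms(3-)
proof (induction "card F" arbitrary: F p rule: less_induct)
  case less
  note F = less.prems(1,2) and p = less.prems(3)
  let ?K = "moment_set S d m h" and ?W = "atomic_measure S d"
  \<comment> \<open>The induction hypothesis in the form used: it serves \<open>p\<close> itself if
    a weight vanishes, and later both end points \<open>q\<close> and \<open>r\<close>.\<close>
  have drop: "\<exists>\<nu>\<in>moment_set_pts S d m h (m + 1). g (?W F q) \<le> g \<nu>"
    if q: "moment_weights m h F q" "z \<in> F" "q z = 0" for q z
  proof -
    have "?W F q = ?W (F - {z}) q"
      using F q by (intro atomic_measure_remove_zero) (auto simp: moment_weights_def)
    moreover have "card (F - {z}) < card F"
      using F q by (intro psubset_card_mono) auto
    ultimately show ?thesis
      using less.hyps[of "F - {z}" q] F moment_weights_remove_zero[OF F(1) q(1,3)] by auto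
  qed
  consider "card F \<le> m + 1" | z where "z \<in> F" "p z = 0"
    | "m + 1 < card F" "\<And>x. x \<in> F \<Longrightarrow> 0 < p x"
    using p unfolding moment_weights_def by (meson less_eq_real_def not_le)
  then show ?case
  proof cases
    case 1
    have "measure (?W F p) F = 1"
      using S F p by (intro atomic_measure_in_finite_dists) (auto simp: moment_weights_def)
    then have "?W F p \<in> moment_set_pts S d m h (m + 1)"
      using 1 F atomic_measure_in_moment_set[OF S F p] by (auto simp: moment_set_pts_def)
    then show ?thesis by blast
  next
    case 2
    then show ?thesis using drop p by blast
  next
    case 3
    obtain v where v: "\<exists>x\<in>F. v x \<noteq> 0"
      "\<forall>i<m + 1. (\<Sum>x\<in>F. (if i = 0 then 1 else h i x) * v x) = 0"
      using exists_nontrivial_solution[OF F(1) 3(1), of "\<lambda>i x. if i = 0 then 1 else h i x"] by blast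
    have v0: "(\<Sum>x\<in>F. v x) = 0" using v(2)[rule_format, of 0] by simp
    have vh: "(\<Sum>x\<in>F. h i x * v x) = 0" if "i \<in> {1..m}" for i
      using v(2)[rule_format, of i] that by simp
    note signs = exists_signs_of_sum_eq_0[OF F(1) v0 v(1)]
    \<comment> \<open>Mass and moments are constant along the whole line, for \<open>t\<close> of
      either sign; only nonnegativity limits the step.\<close>
    have weights: "moment_weights m h F (\<lambda>x. p x + t * v x)"
      if "\<And>x. x \<in> F \<Longrightarrow> 0 \<le> p x + t * v x" for t
      using that p v0 vh
      by (simp add: moment_weights_def sum.distrib distrib_left mult.left_commute[of _ t]
          sum_distrib_left[symmetric])
    obtain s y where s: "0 < s" "y \<in> F" "p y + s * v y = 0" "\<And>x. x \<in> F \<Longrightarrow> 0 \<le> p x + s * v x"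
      using exists_boundary_step[of F p v] F(1) 3(2) signs(1) by blast
    obtain t z where t: "0 < t" "z \<in> F" "p z - t * v z = 0" "\<And>x. x \<in> F \<Longrightarrow> 0 \<le> p x - t * v x"
      using exists_boundary_step[of F p "\<lambda>x. - v x"] F(1) 3(2) signs(2) by auto
    define q r where "q = (\<lambda>x. p x + s * v x)" and "r = (\<lambda>x. p x - t * v x)"
    have q: "moment_weights m h F q"
      unfolding q_def using s(4) by (rule weights)
    have r: "moment_weights m h F r"
      using weights[of "- t"] t(4) by (simp add: r_def)
    \<comment> \<open>Chosen so that \<open>\<alpha> * s = (1 - \<alpha>) * t\<close>: the
      displacements \<open>s\<close> along \<open>v\<close> and \<open>t\<close> against it cancel
      in the mixture.\<close>
    define \<alpha> where "\<alpha> = t / (s + t)"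
    have \<alpha>: "0 < \<alpha>" "\<alpha> < 1" using s(1) t(1) by (auto simp: \<alpha>_def)
    have "\<alpha> * q x + (1 - \<alpha>) * r x = p x" for x
    proof -
      have "\<alpha> * s = (1 - \<alpha>) * t" using s(1) t(1) by (simp add: \<alpha>_def field_simps)
      then have "\<alpha> * s * v x = (1 - \<alpha>) * t * v x" by simp
      then show ?thesis by (simp add: q_def r_def algebra_simps)
    qed
    then have "mixture \<alpha> (?W F q) (?W F r) = ?W F p"
      using mixture_atomic_measure[OF F \<alpha>, of q r d] q r by (simp add: moment_weights_def)
    then have "g (?W F p) \<le> max (g (?W F q)) (g (?W F r))"
      using g \<alpha> atomic_measure_in_moment_set[OF S F q] atomic_measure_in_moment_set[OF S F r]
      by (metis greaterThanLessThan_iff quasiconvex_on_def)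
    moreover have "q y = 0" "r z = 0" using s t by (auto simp: q_def r_def)
    \<comment> \<open>The larger of the two end values bounds the value at \<open>p\<close>, and
      either end point has lost an atom.\<close>
    ultimately show ?thesis
      using drop[OF q s(2)] drop[OF r t(2)] by (meson le_max_iff_disj order_trans)
  qed
qed

section \<open>From pointwise domination to equality of suprema\<close>

theorem theorem1:
  fixes S :: "'a set" and d :: "'a \<Rightarrow> 'a \<Rightarrow> real"
    and m :: nat and h :: "nat \<Rightarrow> 'a \<Rightarrow> real"
    and g :: "'a measure \<Rightarrow> real"
  assumes "Metric_space S d"
    and "quasiconvex_on (moment_set S d m h) g"
  shows "sup0 ((\<lambda>\<mu>. ereal (g \<mu>)) ` moment_set S d m h) =
         sup0 ((\<lambda>\<mu>. ereal (g \<mu>)) ` moment_set_pts S d m h (m + 1))"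
proof -
  let ?K = "moment_set S d m h" and ?K' = "moment_set_pts S d m h (m + 1)"
  have sub: "?K' \<subseteq> ?K" by (auto simp: moment_set_pts_def)
  have ge: "\<exists>\<nu>\<in>?K'. g \<mu> \<le> g \<nu>" if \<mu>: "\<mu> \<in> ?K" for \<mu>
  proof -
    have D: "\<mu> \<in> finite_dists S d" using \<mu> by (simp add: moment_set_def)
    then obtain F where F: "finite F" "F \<subseteq> S" "measure \<mu> F = 1"
      by (auto simp: finite_dists_def)
    note sum = pairing_eq_sum[OF assms(1) D F]
    interpret prob_space \<mu> using D by (simp add: finite_dists_def)
    \<comment> \<open>\<open>F\<close> may contain points of mass zero; only its total mass is
      known, and it is split over the singletons.\<close>
    have "(\<Sum>x\<in>F. prob {x}) = 1"
    proof -
      have "{x} \<in> sets \<mu>" if "x \<in> F" for x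
        using that F D finite_in_sets_metric_borel[OF assms(1), of "{x}"]
        by (auto simp: finite_dists_def)
      then show ?thesis
        using finite_measure_eq_sum_singleton[OF F(1)] F(3) by simp
    qed
    then have "moment_weights m h F (\<lambda>x. prob {x})"
      using \<mu> by (simp add: moment_weights_def moment_set_def sum)
    then show ?thesis
      using exists_few_atoms_quasiconvex_ge[OF assms F(1,2)] eq_atomic_measure[OF assms(1) D F]
      by metis
  qed
  have "Sup ((\<lambda>\<mu>. ereal (g \<mu>)) ` ?K) = Sup ((\<lambda>\<mu>. ereal (g \<mu>)) ` ?K')"
    using ge sub by (intro antisym SUP_mono SUP_subset_mono) auto
  \<comment> \<open>\<open>sup0\<close> has the special value 0 on the empty set, so both sets must
    be empty together; \<open>ge\<close> gives a point of \<open>?K'\<close> as soon as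
    \<open>?K\<close> has one.\<close>
  moreover have "?K = {} \<longleftrightarrow> ?K' = {}" using ge sub by blast
  ultimately show ?thesis by (simp add: sup0_def)
qed

end
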